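(* For any compact set $J\subset\mathbb{S}^2$ there exists a spherical random field $T(\mathbf{x})$, $\mathbf{x}\in\mathbb{S}^2$, that is isotropic at each point of $J$ and is not isotropic at any point of $\mathbb{S}^2\setminus J$.
   Context: $\mathbb{S}^2$ is the unit sphere in $\mathbb{R}^3$ and $\gamma$ is the great-circle (angular) distance. Standing assumptions: a spherical random field is a real-valued second-order random field $T$ on $\mathbb{S}^2$ with zero mean whose covariance function $C(\mathbf{x}_1,\mathbf{x}_2)=\mathbf{E}(T(\mathbf{x}_1)T(\mathbf{x}_2))$ is continuous on $\mathbb{S}^2\times\mathbb{S}^2$ and not identically constant. The field is isotropic at a point $\mathbf{x}_0$ if there is a function $B_{\mathbf{x}_0}:[0,\pi]\to\mathbb{R}$ with $C(\mathbf{x}_0,\mathbf{x})=B_{\mathbf{x}_0}(\gamma(\mathbf{x}_0,\mathbf{x}))$ for all $\mathbf{x}\in\mathbb{S}^2$. *)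

theory Defs
  imports "HOL-Probability.Probability"
begin

abbreviation S2 :: "(real^3) set" where
  "S2 \<equiv> sphere 0 1"

definition great_circle_dist :: "real^3 \<Rightarrow> real^3 \<Rightarrow> real" where
  "great_circle_dist x y = arccos (x \<bullet> y)"

text \<open>A field is a family of random variables \<open>T x\<close> on a probability space \<open>M\<close>; only the values
  at points \<open>x\<close> of the sphere are relevant.\<close>

definition field_cov :: "'w measure \<Rightarrow> (real^3 \<Rightarrow> 'w \<Rightarrow> real) \<Rightarrow> real^3 \<Rightarrow> real^3 \<Rightarrow> real" where
  "field_cov M T x1 x2 = (LINT \<omega>|M. T x1 \<omega> * T x2 \<omega>)"

definition spherical_random_field :: "'w measure \<Rightarrow> (real^3 \<Rightarrow> 'w \<Rightarrow> real) \<Rightarrow> bool" where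
  "spherical_random_field M T \<longleftrightarrow>
     prob_space M \<and>
     (\<forall>x\<in>S2. T x \<in> borel_measurable M
        \<and> integrable M (\<lambda>\<omega>. (T x \<omega>)\<^sup>2)
        \<and> (LINT \<omega>|M. T x \<omega>) = 0) \<and>
     continuous_on (S2 \<times> S2) (\<lambda>(x1, x2). field_cov M T x1 x2) \<and>
     \<not> (\<lambda>(x1, x2). field_cov M T x1 x2) constant_on (S2 \<times> S2)"

text \<open>\<open>B\<close> is only evaluated on the interval from \<open>0\<close> to \<open>pi\<close>, the range of the
  great-circle distance on the sphere.\<close>

definition isotropic_at :: "'w measure \<Rightarrow> (real^3 \<Rightarrow> 'w \<Rightarrow> real) \<Rightarrow> real^3 \<Rightarrow> bool" where
  "isotropic_at M T x0 \<longleftrightarrow>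
     (\<exists>B :: real \<Rightarrow> real. \<forall>x\<in>S2. field_cov M T x0 x = B (great_circle_dist x0 x))"

end

theory Submission imports Defs begin

text \<open>If \<open>J\<close> is the whole sphere, a field with covariance \<open>x \<bullet> y\<close> works. Otherwise take a field
  \<open>T x = f x * \<xi>\<close> of rank one, with covariance \<open>f x * f y\<close>, where the continuous function \<open>f\<close>
  vanishes exactly on \<open>J\<close> and attains its maximum exactly at two points \<open>a\<close>, \<open>b\<close> with
  \<open>a \<noteq> b\<close>, \<open>a \<noteq> - b\<close>. Isotropy at \<open>x0 \<notin> J\<close> would make \<open>f\<close> rotationally symmetric about \<open>x0\<close>; the
  circles about \<open>x0\<close> through \<open>a\<close> and \<open>b\<close> would then lie in \<open>{a, b}\<close>, forcing both points to be
  \<open>x0\<close> or \<open>- x0\<close>.\<close>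

lemma inner_real3: "(x :: real^3) \<bullet> y = x$1 * y$1 + x$2 * y$2 + x$3 * y$3"
  by (simp add: inner_vec_def sum_3)

lemma neg_eq_self_iff: "- x = x \<longleftrightarrow> x = 0" for x :: "'a::real_vector"
  by (metis add.right_inverse scaleR_2 scaleR_eq_0_iff neg_0_equal_iff_equal zero_neq_numeral)

text \<open>The driving noise is uniform on the vertices of a regular tetrahedron, which have mean zero
  and the identity as covariance matrix.\<close>

definition tetrahedron :: "real \<Rightarrow> real^3" where
  "tetrahedron \<omega> = (if \<omega> = 0 then vector [1, 1, 1] else if \<omega> = 1 then vector [1, -1, -1]
     else if \<omega> = 2 then vector [-1, 1, -1] else vector [-1, -1, 1])"

text \<open>Pairing the tetrahedral noise with the vector \<open>g x\<close> turns its identity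
  covariance matrix into the kernel \<open>g x \<bullet> g y\<close>. The points \<open>x\<close>,
  \<open>y\<close> witness that this kernel is not constant.\<close>

lemma ex_spherical_random_field:
  fixes g :: "real^3 \<Rightarrow> real^3"
  assumes cont: "continuous_on S2 g"
    and xy: "x \<in> S2" "y \<in> S2" "g x \<bullet> g x \<noteq> g x \<bullet> g y"
  obtains M :: "real measure" and T
  where "spherical_random_field M T" "\<And>x y. field_cov M T x y = g x \<bullet> g y"
proof
  let ?M = "measure_pmf (pmf_of_set {0, 1, 2, 3 :: real})"
  let ?T = "\<lambda>x \<omega>. tetrahedron \<omega> \<bullet> g x"
  show cov: "field_cov ?M ?T x y = g x \<bullet> g y" for x y
    by (simp add: field_cov_def integral_pmf_of_set tetrahedron_def inner_real3 algebra_simps)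
  have "(LINT \<omega>|?M. ?T x \<omega>) = 0" for x
    by (simp add: integral_pmf_of_set tetrahedron_def inner_real3 algebra_simps)
  moreover have "integrable ?M (\<lambda>\<omega>. (?T x \<omega>)\<^sup>2)" for x
    by (rule integrable_measure_pmf_finite) simp
  moreover have "continuous_on (S2 \<times> S2) (\<lambda>(x1, x2). field_cov ?M ?T x1 x2)"
    unfolding cov case_prod_beta
    by (intro continuous_intros continuous_on_compose2[OF cont]) auto
  moreover have "\<not> (\<lambda>(x1, x2). field_cov ?M ?T x1 x2) constant_on (S2 \<times> S2)"
    unfolding cov constant_on_def using xy by (metis (no_types, lifting) SigmaI case_prod_conv)
  ultimately show "spherical_random_field ?M ?T"
    unfolding spherical_random_field_def by (auto intro: measure_pmf.prob_space_axioms)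
qed

text \<open>Inner products of unit vectors lie in [-1, 1], where \<open>cos\<close> inverts
  \<open>arccos\<close>, so functions of the distance and functions of the inner product are
  interchangeable.\<close>

lemma isotropic_at_iff:
  assumes "x0 \<in> S2"
  shows "isotropic_at M T x0 \<longleftrightarrow> (\<exists>B. \<forall>x\<in>S2. field_cov M T x0 x = B (x0 \<bullet> x))"
proof -
  have "cos (great_circle_dist x0 x) = x0 \<bullet> x" if "x \<in> S2" for x
    using Cauchy_Schwarz_ineq2[of x0 x] assms that
    by (simp add: great_circle_dist_def cos_arccos_abs)
  then have "isotropic_at M T x0" if "\<forall>x\<in>S2. field_cov M T x0 x = B (x0 \<bullet> x)" for B
    unfolding isotropic_at_def using that by (intro exI[of _ "\<lambda>t. B (cos t)"]) auto
  moreover have "\<exists>B. \<forall>x\<in>S2. field_cov M T x0 x = B (x0 \<bullet> x)" if "isotropic_at M T x0"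
    using that unfolding isotropic_at_def great_circle_dist_def
    by (elim exE) (rule exI[of _ "\<lambda>t. _ (arccos t)"])
  ultimately show ?thesis
    by blast
qed

text \<open>Rotating \<open>a\<close> about \<open>x0\<close> by a half turn and by a quarter turn gives two further points of
  its circle.\<close>

lemma circle_within_pair:
  fixes x0 a b :: "real^3"
  assumes norms: "norm x0 = 1" "norm a = 1"
    and circle: "\<And>x. x \<in> S2 \<Longrightarrow> x0 \<bullet> x = x0 \<bullet> a \<Longrightarrow> x \<in> {a, b}"
  shows "a = x0 \<or> a = - x0"
proof -
  define c where "c = x0 \<bullet> a"
  define u where "u = a - c *\<^sub>R x0"
  have x0: "x0 \<bullet> x0 = 1" and a: "a \<bullet> a = 1"
    using norms by (simp_all add: dot_square_norm)
  have perp: "x0 \<bullet> u = 0" "u \<bullet> x0 = 0"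
    by (simp_all add: u_def c_def x0 inner_diff_right inner_diff_left inner_commute)
  have u: "u \<bullet> u = 1 - c\<^sup>2"
    by (simp add: u_def c_def x0 a inner_diff_right inner_diff_left inner_commute
        power2_eq_square)
  have on_circle: "c *\<^sub>R x0 + w \<in> {a, b}" if "x0 \<bullet> w = 0" "w \<bullet> w = 1 - c\<^sup>2" for w
  proof (rule circle)
    have "(c *\<^sub>R x0 + w) \<bullet> (c *\<^sub>R x0 + w) = 1"
      using that by (simp add: x0 inner_add_left inner_add_right inner_commute power2_eq_square)
    then show "c *\<^sub>R x0 + w \<in> S2"
      by (simp add: norm_eq_1)
    show "x0 \<bullet> (c *\<^sub>R x0 + w) = x0 \<bullet> a"
      using that by (simp add: inner_add_right x0 c_def)
  qed
  \<comment> \<open>The quarter turn of \<open>u\<close> about \<open>x0\<close>: orthogonal to both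
    and, as \<open>x0\<close> is a unit vector orthogonal to \<open>u\<close>, of the same length as
    \<open>u\<close>.\<close>
  define v where "v = cross3 x0 u"
  have v: "x0 \<bullet> v = 0" "u \<bullet> v = 0"
    by (simp_all add: v_def dot_cross_self)
  have vv: "v \<bullet> v = u \<bullet> u"
    using norm_cross_dot[of x0 u] perp norms(1)
    by (simp add: v_def dot_square_norm)
  have a_eq: "a = c *\<^sub>R x0 + u"
    by (simp add: u_def)
  have "c *\<^sub>R x0 + (- u) \<in> {a, b}" "c *\<^sub>R x0 + v \<in> {a, b}"
    by (rule on_circle; use perp u v vv in simp)+
  \<comment> \<open>Pigeonhole: the offsets \<open>u\<close>, \<open>- u\<close> and
    \<open>v\<close> give three points in a set of at most two. Since \<open>u\<close> and
    \<open>v\<close> are orthogonal, any coincidence forces \<open>u = 0\<close>.\<close>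
  then have "- u = u \<or> v = u \<or> v = - u"
    using a_eq by auto
  then have "u = 0"
    using v(2) by (auto simp: neg_eq_self_iff)
  then have "a = c *\<^sub>R x0" "c\<^sup>2 = 1"
    using a_eq u by auto
  then show ?thesis
    by (auto simp: power2_eq_1_iff)
qed

lemma ex_two_peaked_function:
  fixes J :: "(real^3) set"
  assumes "compact J" "J \<subset> S2"
  obtains f :: "real^3 \<Rightarrow> real" and a b
  where "continuous_on S2 f" "\<And>x. x \<in> S2 \<Longrightarrow> f x = 0 \<longleftrightarrow> x \<in> J"
    "a \<in> S2" "b \<in> S2" "a \<noteq> b" "a \<noteq> - b" "\<And>x. f x = 1 \<longleftrightarrow> x \<in> {a, b}"
proof -
  text \<open>The extra point \<open>0\<close> avoids the junk value \<open>infdist x {} = 0\<close>.\<close>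
  define K where "K = insert 0 J"
  have K: "closed K" "K \<noteq> {}"
    using assms(1) by (auto simp: K_def compact_imp_closed)
  obtain a where a: "a \<in> S2" "a \<notin> J"
    using assms(2) by (meson psubset_imp_ex_mem DiffE)
  then have "a \<notin> K"
    by (auto simp: K_def)
  then have "open (- K)" "a \<in> - K"
    using K by auto
  then obtain r where r: "r > 0" "ball a r \<subseteq> - K"
    using openE by blast
  have "- a \<in> S2" "- a \<noteq> a"
    using a(1) by (auto simp: neg_eq_self_iff)
  \<comment> \<open>A connected set with more than one point has no isolated points.\<close>
  then have "a islimpt S2"
    by (intro connected_imp_perfect connected_sphere a(1)) (simp, metis a(1) singletonD)
  \<comment> \<open>The bound \<open>r\<close> keeps \<open>b\<close> off \<open>K\<close>; the
    bound 1 excludes \<open>a = - b\<close>, since antipodal points are at distance 2.\<close>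
  then obtain b where b: "b \<in> S2" "b \<noteq> a" "dist b a < min r 1"
    unfolding islimpt_approachable using r(1) by (metis min_less_iff_conj zero_less_one)
  have "a \<noteq> - b"
  proof
    assume "a = - b"
    then have "dist b a = norm (2 *\<^sub>R b)"
      by (simp add: dist_norm scaleR_2)
    then show False
      using b by simp
  qed
  have bK: "b \<notin> K"
    using b(3) r(2) by (auto simp: dist_commute)
  define m where "m = min (infdist a K) (infdist b K)"
  have m: "m > 0"
    using in_closed_iff_infdist_zero[OF K] \<open>a \<notin> K\<close> bK infdist_nonneg
    by (auto simp: m_def less_le min_def)
  \<comment> \<open>The numerator lies in [0, 1], vanishes exactly on \<open>K\<close>, and by the
    choice of \<open>m\<close> equals 1 at \<open>a\<close> and \<open>b\<close>. The denominator is
    at least 1, with equality only at \<open>a\<close> and \<open>b\<close>.\<close>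
  define f where "f x = min (infdist x K / m) 1 / (1 + dist x a * dist x b)" for x
  have den: "1 + dist x a * dist x b > 0" for x
    by (simp add: add_pos_nonneg)
  show ?thesis
  proof
    show "continuous_on S2 f"
      unfolding f_def using den m
      by (intro continuous_intros) (auto simp: less_le)
    show "f x = 0 \<longleftrightarrow> x \<in> J" if "x \<in> S2" for x
    proof -
      have "f x = 0 \<longleftrightarrow> infdist x K = 0"
        using den[of x] m by (auto simp: f_def min_def)
      moreover have "x \<in> K \<longleftrightarrow> x \<in> J"
        using that by (auto simp: K_def)
      ultimately show ?thesis
        using in_closed_iff_infdist_zero[OF K] by blast
    qed
    show "f x = 1 \<longleftrightarrow> x \<in> {a, b}" for x
    proof
      assume "f x = 1"
      then have "1 + dist x a * dist x b = min (infdist x K / m) 1"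
        using den[of x] by (simp add: f_def)
      then have "dist x a * dist x b \<le> 0"
        by linarith
      then show "x \<in> {a, b}"
        by (auto simp: mult_le_0_iff)
    next
      assume "x \<in> {a, b}"
      then have "infdist x K / m \<ge> 1"
        using m by (auto simp: m_def)
      then show "f x = 1"
        using \<open>x \<in> {a, b}\<close> by (auto simp: f_def)
    qed
  qed (use a b \<open>a \<noteq> - b\<close> in auto)
qed

theorem theorem4:
  fixes J :: "(real^3) set"
  assumes "compact J" and "J \<subseteq> S2"
  shows "\<exists>(M :: real measure) (T :: real^3 \<Rightarrow> real \<Rightarrow> real).
           spherical_random_field M T \<and>
           (\<forall>x\<in>J. isotropic_at M T x) \<and>
           (\<forall>x\<in>S2 - J. \<not> isotropic_at M T x)"
proof (cases "J = S2")
  case True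
  let ?e = "axis 1 1 :: real^3"
  have "?e \<in> S2" "- ?e \<in> S2" "?e \<bullet> ?e \<noteq> ?e \<bullet> (- ?e)"
    by (simp_all add: inner_axis_axis)
  then obtain M :: "real measure" and T
    where MT: "spherical_random_field M T" "\<And>x y. field_cov M T x y = x \<bullet> y"
    using ex_spherical_random_field[OF continuous_on_id] by blast
  then have "isotropic_at M T x" if "x \<in> S2" for x
    using that by (auto simp: isotropic_at_iff)
  with True MT(1) show ?thesis
    by blast
next
  case False
  with assms obtain f :: "real^3 \<Rightarrow> real" and a b
    where f: "continuous_on S2 f" "\<And>x. x \<in> S2 \<Longrightarrow> f x = 0 \<longleftrightarrow> x \<in> J"
      and ab: "a \<in> S2" "b \<in> S2" "a \<noteq> b" "a \<noteq> - b"
      and peak: "\<And>x. f x = 1 \<longleftrightarrow> x \<in> {a, b}"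
    using ex_two_peaked_function[of J] by (metis psubsetI)
  let ?e = "axis 1 1 :: real^3"
  let ?g = "\<lambda>x. f x *\<^sub>R ?e"
  have g: "?g x \<bullet> ?g y = f x * f y" for x y
    by (simp add: inner_axis_axis)
  \<comment> \<open>As \<open>f a = 1\<close> and \<open>f (- a) \<noteq> 1\<close>, the covariance
    takes different values at \<open>(a, a)\<close> and \<open>(a, - a)\<close>.\<close>
  have "- a \<in> S2" "- a \<noteq> a" "- a \<noteq> b"
    using ab by (auto simp: neg_eq_self_iff)
  then have "?g a \<bullet> ?g a \<noteq> ?g a \<bullet> ?g (- a)"
    unfolding g using peak[of a] peak[of "- a"] by auto
  moreover have "continuous_on S2 ?g"
    by (intro continuous_intros f)
  ultimately obtain M :: "real measure" and T
    where MT: "spherical_random_field M T" "\<And>x y. field_cov M T x y = f x * f y"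
    using ex_spherical_random_field[of ?g a "- a"] ab(1) \<open>- a \<in> S2\<close> unfolding g by metis
  have "isotropic_at M T x" if "x \<in> J" for x
  proof -
    have "f x = 0"
      using f(2) that assms(2) by blast
    then show ?thesis
      by (auto simp: isotropic_at_def MT(2))
  qed
  moreover have "\<not> isotropic_at M T x0" if x0: "x0 \<in> S2 - J" for x0
  proof
    assume "isotropic_at M T x0"
    then obtain B where B: "\<And>x. x \<in> S2 \<Longrightarrow> f x0 * f x = B (x0 \<bullet> x)"
      using isotropic_at_iff[of x0 M T] x0 unfolding MT(2) by auto
    have "f x0 \<noteq> 0"
      using f(2) x0 by auto
    then have zonal: "f x = f y" if "x \<in> S2" "y \<in> S2" "x0 \<bullet> x = x0 \<bullet> y" for x y
      using B that by (metis mult_left_cancel)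
    have "p = x0 \<or> p = - x0" if p: "p \<in> {a, b}" for p
    proof -
      have "p \<in> S2"
        using p ab by auto
      have "x \<in> {a, b}" if "x \<in> S2" "x0 \<bullet> x = x0 \<bullet> p" for x
        using zonal[OF that(1) \<open>p \<in> S2\<close> that(2)] peak p by metis
      \<comment> \<open>Here \<open>q\<close> is the other peak, so that one argument covers both
        \<open>p = a\<close> and \<open>p = b\<close>.\<close>
      then obtain q where "x \<in> {p, q}" if "x \<in> S2" "x0 \<bullet> x = x0 \<bullet> p" for x
        using p by blast
      then show ?thesis
        using circle_within_pair[of x0 p q] x0 \<open>p \<in> S2\<close> by auto
    qed
    \<comment> \<open>Two points of \<open>{x0, - x0}\<close> are equal or antipodal.\<close>
    from this[of a] this[of b] show False
      using ab by auto
  qed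
  ultimately show ?thesis
    using MT(1) by blast
qed

end
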